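(* Let $f:[a,b]\to\mathbb{R}$ be a differentiable mapping on $(a,b)$ with $a<b$ and $f'\in L[a,b]$. If $g:[a,b]\to\mathbb{R}$ is integrable and symmetric to $(a+b)/2$, then the following equality for fractional integrals holds: $$\left(\frac{f(a)+f(b)}{2}\right)\left[J_{a+}^{\alpha}g(b)+J_{b-}^{\alpha}g(a)\right]-\left[J_{a+}^{\alpha}(fg)(b)+J_{b-}^{\alpha}(fg)(a)\right]=\frac{1}{\Gamma(\alpha)}\int_a^b\left[\int_a^t (b-s)^{\alpha-1}g(s)\,ds-\int_t^b (s-a)^{\alpha-1}g(s)\,ds\right]f'(t)\,dt$$ with $\alpha>0$.
   Context: $L[a,b]$ denotes the space of integrable functions on $[a,b]$. For $h\in L[a,b]$, the Riemann-Liouville fractional integrals of order $\alpha>0$, with $a\ge 0$, are defined by $$J_{a+}^{\alpha}h(x)=\frac{1}{\Gamma(\alpha)}\int_a^x (x-t)^{\alpha-1}h(t)\,dt\quad (x>a),\qquad J_{b-}^{\alpha}h(x)=\frac{1}{\Gamma(\alpha)}\int_x^b (t-x)^{\alpha-1}h(t)\,dt\quad (x<b),$$ where $\Gamma(\alpha)=\int_0^\infty e^{-t}t^{\alpha-1}\,dt$ is the Gamma function. "$g$ is symmetric to $(a+b)/2$" means $g(a+b-x)=g(x)$ for all $x\in[a,b]$. $fg$ denotes the pointwise product of $f$ and $g$.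
   Formalization: The formal theorem also assumes that f is continuous on [a,b] (otherwise f(a), f(b) are unconstrained and the equality fails) and, for α<1, that the integral defining J_{a+}^α g(b) converges (it may diverge for merely integrable g). *)

theory Defs
  imports "HOL-Analysis.Analysis"
begin

text \<open>
  Riemann-Liouville fractional integrals. The argument order is: order of integration, fixed
  endpoint, function, point of evaluation. They are Lebesgue integrals; \<^term>\<open>0 powr (\<alpha> - 1) = (0::real)\<close>
  at the singular end of the kernel concerns a single point only. If the integral does not
  converge, the value is 0 by the library's convention.
\<close>

definition RL_left :: "real \<Rightarrow> real \<Rightarrow> (real \<Rightarrow> real) \<Rightarrow> real \<Rightarrow> real" where
  "RL_left \<alpha> a h x =
     1 / Gamma \<alpha> * (LINT t:{a..x}|lebesgue. (x - t) powr (\<alpha> - 1) * h t)"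

definition RL_right :: "real \<Rightarrow> real \<Rightarrow> (real \<Rightarrow> real) \<Rightarrow> real \<Rightarrow> real" where
  "RL_right \<alpha> b h x =
     1 / Gamma \<alpha> * (LINT t:{x..b}|lebesgue. (t - x) powr (\<alpha> - 1) * h t)"

text \<open>
  Convergence of the integral in \<^const>\<open>RL_left\<close>. For \<open>0 < \<alpha> < 1\<close>, an integrable function has
  a convergent fractional integral at almost every point, but not necessarily at a given one.
\<close>

definition RL_left_exists :: "real \<Rightarrow> real \<Rightarrow> (real \<Rightarrow> real) \<Rightarrow> real \<Rightarrow> bool" where
  "RL_left_exists \<alpha> a h x \<longleftrightarrow>
     set_integrable lebesgue {a..x} (\<lambda>t. (x - t) powr (\<alpha> - 1) * h t)"

end

theory Submission
  imports Defs
begin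

text \<open>
  Put \<open>u s = (b - s) powr (\<alpha> - 1) * g s\<close> and \<open>v s = (s - a) powr (\<alpha> - 1) * g s\<close>. Fubini's theorem
  on a triangle, together with \<open>f y - f x = \<integral>\<^sub>x\<^sup>y f'\<close>, turns the right-hand integral into
  \<open>\<integral> u s (f b - f s) ds - \<integral> v s (f s - f a) ds\<close>. The symmetry of \<open>g\<close> makes \<open>v\<close> the reflection
  of \<open>u\<close>, so \<open>\<integral> u = \<integral> v\<close> and the terms with \<open>f a\<close> and \<open>f b\<close> combine to the trapezoid term.
\<close>

text \<open>Completion leaves the measure of Borel sets unchanged, so a countable Borel cover of
  finite measure for \<open>lborel\<close> still serves. This opens Fubini's theorem to functions
  that are merely Lebesgue measurable.\<close>

lemma sigma_finite_lebesgue: "sigma_finite_measure (lebesgue :: 'a::euclidean_space measure)"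
proof
  obtain A :: "'a set set" where A: "countable A" "A \<subseteq> sets lborel" "\<Union>A = space lborel"
      "\<forall>a\<in>A. emeasure lborel a \<noteq> \<infinity>"
    using lborel.sigma_finite_countable by metis
  then show "\<exists>A::'a set set. countable A \<and> A \<subseteq> sets lebesgue \<and> \<Union>A = space lebesgue
      \<and> (\<forall>a\<in>A. emeasure lebesgue a \<noteq> \<infinity>)"
    by (intro exI[of _ A]) (auto simp: subset_iff)
qed

lemma (in pair_sigma_finite) integrable_pair_mult:
  fixes f :: "'a \<Rightarrow> real" and g :: "'b \<Rightarrow> real"
  assumes [measurable]: "integrable M1 f" and g [measurable]: "integrable M2 g"
  shows "integrable (M1 \<Otimes>\<^sub>M M2) (\<lambda>(x, y). f x * g y)"
proof (rule Fubini_integrable)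
  show "(\<lambda>(x, y). f x * g y) \<in> borel_measurable (M1 \<Otimes>\<^sub>M M2)"
    by measurable
  show "integrable M1 (\<lambda>x. \<integral>y. norm (case (x, y) of (x, y) \<Rightarrow> f x * g y) \<partial>M2)"
    using assms by (simp add: abs_mult)
  show "AE x in M1. integrable M2 (\<lambda>y. case (x, y) of (x, y) \<Rightarrow> f x * g y)"
    using g by simp
qed

text \<open>Both sides are iterated integrals of \<open>u s * d t\<close> over the triangle
  \<open>a \<le> s \<le> t \<le> b\<close>. The product is integrable on the whole square, and
  cutting it down to the triangle preserves this.\<close>

lemma set_lebesgue_integral_triangle:
  fixes u d :: "real \<Rightarrow> real"
  assumes "set_integrable lebesgue {a..b} u" and "set_integrable lebesgue {a..b} d"
  shows "set_integrable lebesgue {a..b} (\<lambda>t. (LINT s:{a..t}|lebesgue. u s) * d t)"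
    and "set_integrable lebesgue {a..b} (\<lambda>s. u s * (LINT t:{s..b}|lebesgue. d t))"
    and "(LINT t:{a..b}|lebesgue. (LINT s:{a..t}|lebesgue. u s) * d t)
       = (LINT s:{a..b}|lebesgue. u s * (LINT t:{s..b}|lebesgue. d t))"
proof -
  interpret sigma_finite_measure "lebesgue :: real measure"
    by (rule sigma_finite_lebesgue)
  interpret P: pair_sigma_finite "lebesgue :: real measure" "lebesgue :: real measure" ..
  define U where "U s = indicator {a..b} s * u s" for s
  define D where "D t = indicator {a..b} t * d t" for t
  define T where "T = {p::real \<times> real. fst p \<le> snd p}"
  define k where "k s t = indicator T (s, t) * (U s * D t)" for s t
  have UD: "integrable lebesgue U" "integrable lebesgue D"
    using assms unfolding set_integrable_def U_def D_def by simp_all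
  \<comment> \<open>This lets the order relation defining \<open>T\<close> be measured in the
    product of the two completed measures, where the integrands live.\<close>
  have [measurable]: "(\<lambda>x. x) \<in> lebesgue \<rightarrow>\<^sub>M (borel :: real measure)"
    by (simp add: measurable_completion)
  have T: "T \<in> sets (lebesgue \<Otimes>\<^sub>M lebesgue)"
  proof -
    have "{p \<in> space (lebesgue \<Otimes>\<^sub>M lebesgue). (fst p :: real) \<le> snd p}
        \<in> sets (lebesgue \<Otimes>\<^sub>M lebesgue)"
      by measurable
    then show ?thesis
      by (simp add: T_def space_pair_measure)
  qed
  have k: "integrable (lebesgue \<Otimes>\<^sub>M lebesgue) (\<lambda>(s, t). k s t)"
    using integrable_mult_indicator[OF T P.integrable_pair_mult[OF UD]]
    by (simp add: k_def case_prod_unfold)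
  have inner_s: "(\<integral>s. k s t \<partial>lebesgue)
      = indicator {a..b} t *\<^sub>R ((LINT s:{a..t}|lebesgue. u s) * d t)" for t
  proof (cases "t \<in> {a..b}")
    case True
    then have "k s t = (indicator {a..t} s *\<^sub>R u s) * d t" for s
      by (auto simp: k_def U_def D_def T_def indicator_def)
    then show ?thesis
      using True by (simp add: set_lebesgue_integral_def)
  qed (simp add: k_def D_def)
  have inner_t: "(\<integral>t. k s t \<partial>lebesgue)
      = indicator {a..b} s *\<^sub>R (u s * (LINT t:{s..b}|lebesgue. d t))" for s
  proof (cases "s \<in> {a..b}")
    case True
    then have "k s t = u s * (indicator {s..b} t *\<^sub>R d t)" for t
      by (auto simp: k_def U_def D_def T_def indicator_def)
    then show ?thesis
      using True by (simp add: set_lebesgue_integral_def)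
  qed (simp add: k_def U_def)
  show "set_integrable lebesgue {a..b} (\<lambda>t. (LINT s:{a..t}|lebesgue. u s) * d t)"
    using P.integrable_snd[OF k] by (simp add: inner_s set_integrable_def)
  show "set_integrable lebesgue {a..b} (\<lambda>s. u s * (LINT t:{s..b}|lebesgue. d t))"
    using P.integrable_fst[OF k] by (simp add: inner_t set_integrable_def)
  show "(LINT t:{a..b}|lebesgue. (LINT s:{a..t}|lebesgue. u s) * d t)
       = (LINT s:{a..b}|lebesgue. u s * (LINT t:{s..b}|lebesgue. d t))"
    using P.Fubini_integral[OF k] by (simp only: inner_s inner_t set_lebesgue_integral_def)
qed

text \<open>The derivative may be discontinuous, so the gauge integral supplies the fundamental
  theorem; it ignores the values of \<open>deriv f\<close> at the endpoints. Absolute integrability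
  then identifies the gauge integral with the Lebesgue integral.\<close>

lemma set_lebesgue_integral_deriv:
  fixes f :: "real \<Rightarrow> real"
  assumes "continuous_on {a..b} f" and "f differentiable_on {a<..<b}"
    and "set_integrable lebesgue {a..b} (deriv f)"
    and "a \<le> x" "x \<le> y" "y \<le> b"
  shows "(LINT t:{x..y}|lebesgue. deriv f t) = f y - f x"
proof -
  have "(deriv f has_integral (f y - f x)) {x..y}"
  proof (rule fundamental_theorem_of_calculus_interior)
    show "continuous_on {x..y} f"
      using assms by (auto intro: continuous_on_subset)
    show "(f has_vector_derivative deriv f t) (at t)" if "t \<in> {x<..<y}" for t
    proof -
      have "t \<in> {a<..<b}"
        using that assms by auto
      then have "f differentiable at t"
        using assms(2) by (metis differentiable_on_eq_differentiable_at open_greaterThanLessThan)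
      then show ?thesis
        by (meson DERIV_deriv_iff_real_differentiable has_real_derivative_iff_has_vector_derivative)
    qed
  qed (use assms in auto)
  moreover have "set_integrable lebesgue {x..y} (deriv f)"
    using assms by (auto intro: set_integrable_subset)
  ultimately show ?thesis
    by (metis integral_unique set_lebesgue_integral_eq_integral(2))
qed

text \<open>The substitution \<open>s \<mapsto> a + b - s\<close> maps the interval onto itself and
  preserves Lebesgue measure.\<close>

lemma set_integral_lebesgue_reflect:
  fixes u v :: "real \<Rightarrow> real"
  assumes "\<And>s. s \<in> {a..b} \<Longrightarrow> v s = u (a + b - s)"
  shows "set_integrable lebesgue {a..b} u \<Longrightarrow> set_integrable lebesgue {a..b} v"
    and "(LINT s:{a..b}|lebesgue. v s) = (LINT s:{a..b}|lebesgue. u s)"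
proof -
  have v: "indicator {a..b} s *\<^sub>R v s
      = indicator {a..b} (a + b + (-1) * s) *\<^sub>R u (a + b + (-1) * s)" for s
    using assms by (auto simp: indicator_def)
  show "set_integrable lebesgue {a..b} v" if "set_integrable lebesgue {a..b} u"
    using lebesgue_integrable_real_affine[of "\<lambda>s. indicator {a..b} s *\<^sub>R u s" "-1" "a + b"] that
    unfolding set_integrable_def v by simp
  show "(LINT s:{a..b}|lebesgue. v s) = (LINT s:{a..b}|lebesgue. u s)"
    unfolding set_lebesgue_integral_def v
    using lebesgue_integral_real_affine[of "-1" "\<lambda>s. indicator {a..b} s *\<^sub>R u s" "a + b"] by simp
qed

theorem lemma4:
  fixes f g :: "real \<Rightarrow> real" and a b \<alpha> :: real
  assumes "0 \<le> a" and "a < b" and "0 < \<alpha>"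
    and "continuous_on {a..b} f"
    and "f differentiable_on {a<..<b}"
    and "set_integrable lebesgue {a..b} (deriv f)"
    and "set_integrable lebesgue {a..b} g"
    and "\<forall>x\<in>{a..b}. g (a + b - x) = g x"
    and "\<alpha> < 1 \<Longrightarrow> RL_left_exists \<alpha> a g b"
  shows "(f a + f b) / 2 * (RL_left \<alpha> a g b + RL_right \<alpha> b g a)
           - (RL_left \<alpha> a (\<lambda>x. f x * g x) b + RL_right \<alpha> b (\<lambda>x. f x * g x) a)
         = 1 / Gamma \<alpha> *
           (LINT t:{a..b}|lebesgue.
              ((LINT s:{a..t}|lebesgue. (b - s) powr (\<alpha> - 1) * g s)
               - (LINT s:{t..b}|lebesgue. (s - a) powr (\<alpha> - 1) * g s)) * deriv f t)"
proof -
  define u where "u s = (b - s) powr (\<alpha> - 1) * g s" for s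
  define v where "v s = (s - a) powr (\<alpha> - 1) * g s" for s
  let ?I = "\<lambda>h. LINT s:{a..b}|lebesgue. h s"
  \<comment> \<open>For \<open>\<alpha> < 1\<close> the kernel is unbounded near \<open>b\<close>,
    and convergence is the last hypothesis. For \<open>\<alpha> \<ge> 1\<close> the kernel is
    bounded by its value at \<open>a\<close>.\<close>
  have uint: "set_integrable lebesgue {a..b} u"
  proof (cases "\<alpha> < 1")
    case True
    then show ?thesis
      using assms(9) by (simp add: RL_left_exists_def u_def [abs_def])
  next
    case False
    have "(\<lambda>s. (b - s) powr (\<alpha> - 1)) \<in> borel_measurable (lebesgue_on {a..b})"
      by (intro measurable_restrict_space1 measurable_completion) measurable
    moreover have "bounded ((\<lambda>s. (b - s) powr (\<alpha> - 1)) ` {a..b})"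
      using False by (intro boundedI[of _ "(b - a) powr (\<alpha> - 1)"]) (auto intro!: powr_mono2)
    ultimately show ?thesis
      unfolding u_def [abs_def] using assms(7)
      by (intro absolutely_integrable_bounded_measurable_product_real) auto
  qed
  \<comment> \<open>The symmetry of \<open>g\<close> enters here. Through the reflection,
    convergence of the left fractional integral at \<open>b\<close> yields that of the right one at
    \<open>a\<close>.\<close>
  have uv: "v s = u (a + b - s)" if "s \<in> {a..b}" for s
    using that assms(8) by (simp add: u_def v_def)
  have vint: "set_integrable lebesgue {a..b} v"
    using uv uint by (rule set_integral_lebesgue_reflect(1))
  have Iuv: "?I v = ?I u"
    using uv by (rule set_integral_lebesgue_reflect(2))
  \<comment> \<open>A continuous \<open>f\<close> is bounded on the compact interval; the integrals
    of differences below can therefore be split.\<close>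
  have fmult: "set_integrable lebesgue {a..b} (\<lambda>s. f s * h s)"
    if "set_integrable lebesgue {a..b} h" for h
  proof (rule absolutely_integrable_bounded_measurable_product_real[OF _ _ _ that])
    show "f \<in> borel_measurable (lebesgue_on {a..b})"
      using assms(4) by (simp add: continuous_imp_measurable_on_sets_lebesgue)
    show "bounded (f ` {a..b})"
      using assms(4) by (intro compact_imp_bounded compact_continuous_image) auto
  qed simp
  note FTC = set_lebesgue_integral_deriv[OF assms(4-6)]
  note triangle_u = set_lebesgue_integral_triangle[OF uint assms(6)]
  \<comment> \<open>The roles are exchanged: \<open>v\<close> is integrated over
    \<open>s \<ge> t\<close>, so \<open>deriv f\<close> takes the first slot and \<open>v\<close>
    the second.\<close>
  note triangle_v = set_lebesgue_integral_triangle[OF assms(6) vint]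
  have 1: "?I (\<lambda>t. (LINT s:{a..t}|lebesgue. u s) * deriv f t) = f b * ?I u - ?I (\<lambda>s. f s * u s)"
  proof -
    have "?I (\<lambda>s. u s * (LINT t:{s..b}|lebesgue. deriv f t)) = ?I (\<lambda>s. f b * u s - f s * u s)"
      by (intro set_lebesgue_integral_cong) (auto simp: FTC algebra_simps)
    also have "\<dots> = f b * ?I u - ?I (\<lambda>s. f s * u s)"
      using uint fmult[OF uint] by simp
    finally show ?thesis
      using triangle_u(3) by simp
  qed
  have 2: "?I (\<lambda>t. (LINT s:{t..b}|lebesgue. v s) * deriv f t) = ?I (\<lambda>s. f s * v s) - f a * ?I v"
  proof -
    have "?I (\<lambda>s. (LINT t:{a..s}|lebesgue. deriv f t) * v s) = ?I (\<lambda>s. f s * v s - f a * v s)"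
      by (intro set_lebesgue_integral_cong) (auto simp: FTC algebra_simps)
    also have "\<dots> = ?I (\<lambda>s. f s * v s) - f a * ?I v"
      using vint fmult[OF vint] by simp
    finally show ?thesis
      using triangle_v(3) by (simp add: mult.commute)
  qed
  have "?I (\<lambda>t. ((LINT s:{a..t}|lebesgue. u s) - (LINT s:{t..b}|lebesgue. v s)) * deriv f t)
      = ?I (\<lambda>t. (LINT s:{a..t}|lebesgue. u s) * deriv f t)
        - ?I (\<lambda>t. (LINT s:{t..b}|lebesgue. v s) * deriv f t)"
    \<comment> \<open>Integrability of the two products with \<open>deriv f\<close> justifies
      splitting the integral.\<close>
    using triangle_u(1) triangle_v(2)
    by (simp add: right_diff_distrib mult.commute)
  also have "\<dots> = (f a + f b) * ?I u - (?I (\<lambda>s. f s * u s) + ?I (\<lambda>s. f s * v s))"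
    unfolding 1 2 Iuv by (simp add: algebra_simps)
  finally have main: "?I (\<lambda>t. ((LINT s:{a..t}|lebesgue. u s) - (LINT s:{t..b}|lebesgue. v s)) * deriv f t)
      = (f a + f b) * ?I u - (?I (\<lambda>s. f s * u s) + ?I (\<lambda>s. f s * v s))" .
  have RL: "RL_left \<alpha> a g b = 1 / Gamma \<alpha> * ?I u"
    "RL_right \<alpha> b g a = 1 / Gamma \<alpha> * ?I v"
    "RL_left \<alpha> a (\<lambda>x. f x * g x) b = 1 / Gamma \<alpha> * ?I (\<lambda>s. f s * u s)"
    "RL_right \<alpha> b (\<lambda>x. f x * g x) a = 1 / Gamma \<alpha> * ?I (\<lambda>s. f s * v s)"
    by (simp_all add: RL_left_def RL_right_def u_def v_def mult.left_commute)
  show ?thesis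
    \<comment> \<open>As \<open>u\<close> and \<open>v\<close> have equal integrals, the two
      fractional integrals of \<open>g\<close> coincide, and their sum cancels the factor
      1/2.\<close>
    unfolding RL Iuv u_def[symmetric] v_def[symmetric] main by (simp add: algebra_simps add_divide_distrib)
qed

end
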